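(* Let $R$ be an arbitrary unital associative and commutative ring such that $\frac{1}{3} \in R$. Let $A$ be a unital associative $R$-algebra generated by a set $X$. Then, for every $n \ge 2$, the ideal $T^{(n)}$ of $A$ is generated (as a two-sided ideal in $A$) by the set \[ \bigl\{ [y_1, y_2, \dots , y_n] \mid y_1, y_n \in X; \ y_2, \dots , y_{n-1} \in X \cup X^2 \bigr\} . \]
   Context: $\frac13\in R$ means that $3=1+1+1$ is invertible in $R$. $X^2 = \{ x_1 x_2 \mid x_1, x_2 \in X \}$ is the set of all products of two elements of $X$. Commutators are additive and left-normed: $[a_1,a_2] = a_1a_2 - a_2a_1$ and $[a_1, \dots, a_{m-1}, a_m] = \bigl[[a_1,\dots,a_{m-1}],a_m\bigr]$ for $m>2$. For $n \ge 2$, $T^{(n)} = T^{(n)}(A)$ denotes the two-sided ideal of $A$ generated by all commutators $[a_1, a_2, \dots, a_n]$ with $a_1,\dots,a_n \in A$. "Generated by $X$" means generated as a unital $R$-algebra. *)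

theory Defs
  imports "HOL-Algebra.Module" "HOL-Algebra.Subrings"
begin

text \<open>
  The locale \<open>algebra\<close> of HOL-Algebra requires the algebra to be commutative,
  hence the following non-commutative version.
\<close>

locale assoc_algebra = module R A + A?: ring A
  for R :: "('r, 'c) ring_scheme" and A :: "('r, 'a, 'd) module_scheme" +
  assumes smult_mult_left:
      "\<lbrakk>r \<in> carrier R; a \<in> carrier A; b \<in> carrier A\<rbrakk> \<Longrightarrow>
        (r \<odot>\<^bsub>A\<^esub> a) \<otimes>\<^bsub>A\<^esub> b = r \<odot>\<^bsub>A\<^esub> (a \<otimes>\<^bsub>A\<^esub> b)"
    and smult_mult_right:
      "\<lbrakk>r \<in> carrier R; a \<in> carrier A; b \<in> carrier A\<rbrakk> \<Longrightarrow>
        a \<otimes>\<^bsub>A\<^esub> (r \<odot>\<^bsub>A\<^esub> b) = r \<odot>\<^bsub>A\<^esub> (a \<otimes>\<^bsub>A\<^esub> b)"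

definition unital_subalgebra ::
    "('r, 'c) ring_scheme \<Rightarrow> ('r, 'a, 'd) module_scheme \<Rightarrow> 'a set \<Rightarrow> bool" where
  "unital_subalgebra R A B \<longleftrightarrow>
    subring B A \<and> (\<forall>r\<in>carrier R. \<forall>b\<in>B. r \<odot>\<^bsub>A\<^esub> b \<in> B)"

definition generated_subalgebra ::
    "('r, 'c) ring_scheme \<Rightarrow> ('r, 'a, 'd) module_scheme \<Rightarrow> 'a set \<Rightarrow> 'a set" where
  "generated_subalgebra R A X = \<Inter>{B. unital_subalgebra R A B \<and> X \<subseteq> B}"

definition commutator :: "('a, 'm) ring_scheme \<Rightarrow> 'a \<Rightarrow> 'a \<Rightarrow> 'a" where
  "commutator A a b = (a \<otimes>\<^bsub>A\<^esub> b) \<ominus>\<^bsub>A\<^esub> (b \<otimes>\<^bsub>A\<^esub> a)"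

text \<open>
  The argument list \<open>[a\<^sub>1, \<dots>, a\<^sub>m]\<close> must be nonempty; a one-element list gives \<open>a\<^sub>1\<close>.
\<close>

definition left_normed_commutator :: "('a, 'm) ring_scheme \<Rightarrow> 'a list \<Rightarrow> 'a" where
  "left_normed_commutator A as = foldl (commutator A) (hd as) (tl as)"

definition T_ideal :: "('a, 'm) ring_scheme \<Rightarrow> nat \<Rightarrow> 'a set" where
  "T_ideal A n =
    Idl\<^bsub>A\<^esub> {left_normed_commutator A as | as. length as = n \<and> set as \<subseteq> carrier A}"

end

theory Submission
  imports Defs
begin

text \<open>
  Let \<open>J\<close> be the ideal generated by the short commutators
  \<open>[y\<^sub>1, \<dots>, y\<^sub>n]\<close> of the theorem, and call an element central if all its commutators lie in \<open>J\<close>.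
  Since \<open>[c, \<cdot>]\<close> is a derivation, commuting with the generators is enough for being central, so
  \<open>[v, p\<^sub>2, \<dots>, p\<^bsub>n-1\<^esub>]\<close> is central for \<open>v \<in> X\<close> and \<open>p\<^sub>i \<in> X \<union> X\<^sup>2\<close>. The work is to free the
  entries \<open>p\<^sub>i\<close>. The proof never has to free more than the last two of them, because it
  proceeds from \<open>n - 2\<close> to \<open>n\<close>:

  \<^item> Let \<open>Z\<close> be the set of all \<open>t\<close> that satisfy \<open>[t, a, b] \<in> J\<close> and \<open>t[a, b, c] \<in> J\<close> for all \<open>a, b, c\<close>. It is
    an ideal (\<open>annihilating_centre_ideal\<close>): in the expansion of \<open>[rt, a, b]\<close> the two mixed terms
    \<open>[t, a][r, b] + [t, b][r, a]\<close> cancel, since an element with \<open>[t, A, A] = 0\<close> has \<open>[t, a][b, c]\<close>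
    antisymmetric in \<open>a, b, c\<close>.
  \<^item> If the short commutators of length \<open>n - 2\<close> lie in \<open>Z\<close>, the induction hypothesis, applied to the
    ideal \<open>Z\<close> in place of \<open>J\<close>, puts all commutators of length \<open>n - 2\<close> into \<open>Z\<close>, and two further
    commutations lead into \<open>J\<close>.

  Lengths two and three start the induction. So two statements about commutators \<open>u\<close> and \<open>w\<close> with short
  entries remain. First, if \<open>[u, x]\<close> and \<open>[u, xy]\<close>
  are central for all generators \<open>x, y\<close>, then so is \<open>[u, a]\<close> for every \<open>a\<close>
  (\<open>commutators_central_if_short_ones_are\<close>). Second, if \<open>[w, x]\<close> and \<open>[w, xy]\<close> lie in the second centre
  for all generators \<open>x, y\<close>, then \<open>[w, x]\<close> annihilates every triple commutator
  (\<open>generator_commutator_in_annihilating_centre\<close>). Both rest on one principle, which is where \<open>1/3\<close> enters: a function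
  of four letters that is antisymmetric in the first three and satisfies the Jacobi identity in
  the last three vanishes up to \<open>3\<close>-torsion (\<open>four_letter_identity\<close>).

  All these identities are proved in a ring given by a type, modulo an ideal. They reach the algebra
  \<open>A\<close> through the free ring on letters, which evaluates onto \<open>A\<close>: the letters stand for the elements of \<open>X\<close>
  and for the scalars, so that generation as an \<open>R\<close>-algebra becomes generation as a ring.
  Scalars among the entries do no harm, as they either kill a commutator or can be pulled out of it.
\<close>

section \<open>Commutators in a ring and generating sets\<close>

definition lie :: "'a::ring \<Rightarrow> 'a \<Rightarrow> 'a" (infixl "\<diamond>" 75) where
  "a \<diamond> b = a * b - b * a"

lemma lie_diff_left: "(a - b) \<diamond> c = a \<diamond> c - b \<diamond> c"
  and lie_diff_right: "c \<diamond> (a - b) = c \<diamond> a - c \<diamond> b"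
  and lie_zero_left: "0 \<diamond> c = 0"
  and lie_zero_right: "c \<diamond> 0 = 0"
  and lie_mult_right: "c \<diamond> (a * b) = a * (c \<diamond> b) + (c \<diamond> a) * b"
  by (simp_all add: lie_def algebra_simps)

definition ring_generating :: "'a::ring set \<Rightarrow> bool" where
  "ring_generating X \<longleftrightarrow>
    (\<forall>B. 0 \<in> B \<longrightarrow> X \<subseteq> B \<longrightarrow> (\<forall>a\<in>B. \<forall>b\<in>B. a - b \<in> B \<and> a * b \<in> B) \<longrightarrow> B = UNIV)"

lemma ring_generating_induct:
  assumes "ring_generating X" and "P 0" and "\<And>x. x \<in> X \<Longrightarrow> P x"
    and "\<And>a b. P a \<Longrightarrow> P b \<Longrightarrow> P (a - b)" and "\<And>a b. P a \<Longrightarrow> P b \<Longrightarrow> P (a * b)"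
  shows "P a"
proof -
  have "Collect P = UNIV"
    using assms(1) unfolding ring_generating_def
    by (elim allE[of _ "Collect P"]) (use assms(2-5) in auto)
  then show ?thesis by auto
qed

text \<open>
  The elements that can be multiplied into the property from the right form a subring, so it
  suffices to append one generator at a time.
\<close>

lemma ring_generating_induct_right:
  assumes "ring_generating X" and "P 0" and "\<And>x. x \<in> X \<Longrightarrow> P x"
    and "\<And>a b. P a \<Longrightarrow> P b \<Longrightarrow> P (a - b)" and "\<And>a x. P a \<Longrightarrow> x \<in> X \<Longrightarrow> P (a * x)"
  shows "P a"
proof -
  have "P a \<and> (\<forall>c. P c \<longrightarrow> P (c * a))"
    by (rule ring_generating_induct[OF assms(1)])
       (use assms(2-5) in \<open>auto simp: right_diff_distrib simp flip: mult.assoc\<close>)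
  then show ?thesis ..
qed

section \<open>Commutator identities modulo an ideal\<close>

text \<open>
  An ideal with \<open>3\<close>-torsion-free quotient. In this form the invertibility of \<open>3\<close> visibly passes
  to annihilators and to the second centre, which serve as auxiliary ideals below.
\<close>

locale three_saturated_ideal =
  fixes I :: "'a::ring set"
  assumes zero_mem: "0 \<in> I"
    and diff_mem: "a \<in> I \<Longrightarrow> b \<in> I \<Longrightarrow> a - b \<in> I"
    and left_mem: "a \<in> I \<Longrightarrow> r * a \<in> I"
    and right_mem: "a \<in> I \<Longrightarrow> a * r \<in> I"
    and third_mem: "a + a + a \<in> I \<Longrightarrow> a \<in> I"
begin

lemma uminus_mem: "a \<in> I \<Longrightarrow> - a \<in> I"
  using diff_mem[OF zero_mem] by simp

lemma add_mem: "a \<in> I \<Longrightarrow> b \<in> I \<Longrightarrow> a + b \<in> I"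
  using diff_mem[of a "- b"] uminus_mem by simp

lemma lie_mem: "a \<in> I \<Longrightarrow> a \<diamond> b \<in> I"
  unfolding lie_def by (intro diff_mem left_mem right_mem)

lemmas mems = add_mem diff_mem uminus_mem left_mem right_mem lie_mem

lemma central_mod_if_commutes_with_generators:
  assumes "ring_generating X" and "\<And>x. x \<in> X \<Longrightarrow> c \<diamond> x \<in> I"
  shows "c \<diamond> a \<in> I"
proof (rule ring_generating_induct[OF assms(1), of "\<lambda>a. c \<diamond> a \<in> I"])
  fix a b assume "c \<diamond> a \<in> I" "c \<diamond> b \<in> I"
  then show "c \<diamond> (a - b) \<in> I" "c \<diamond> (a * b) \<in> I"
    by (simp_all add: lie_diff_right lie_mult_right diff_mem add_mem left_mem right_mem)
qed (simp_all add: lie_zero_right zero_mem assms(2))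

text \<open>
  Up to sign, \<open>f\<close> depends only on its last argument, so there are just four values \<open>h\<^sub>a, h\<^sub>b, h\<^sub>c, h\<^sub>d\<close>.
  For each choice of the first argument the cyclic identity says that the other three of
  them add up to zero. Hence the four values agree and their threefold multiple is zero.
\<close>

lemma four_letter_identity:
  assumes Y: "a \<in> Y" "b \<in> Y" "c \<in> Y" "d \<in> Y"
    and anti12: "\<And>p q r s. \<lbrakk>p \<in> Y; q \<in> Y; r \<in> Y; s \<in> Y\<rbrakk> \<Longrightarrow> f p q r s + f q p r s \<in> I"
    and anti23: "\<And>p q r s. \<lbrakk>p \<in> Y; q \<in> Y; r \<in> Y; s \<in> Y\<rbrakk> \<Longrightarrow> f p q r s + f p r q s \<in> I"
    and cyc: "\<And>p q r s. \<lbrakk>p \<in> Y; q \<in> Y; r \<in> Y; s \<in> Y\<rbrakk> \<Longrightarrow> f p q r s + f p r s q + f p s q r \<in> I"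
  shows "f a b c d \<in> I"
proof -
  have rot: "f p q r s - f q r p s \<in> I" if "p \<in> Y" "q \<in> Y" "r \<in> Y" "s \<in> Y" for p q r s
    using diff_mem[OF anti12[of p q r s] anti23[of q p r s]] that by (simp add: algebra_simps)
  have A: "f a b c d + f a c d b + f a d b c \<in> I"
    using cyc Y by blast
  have B: "f a b c d + f a d b c + f b d c a \<in> I"
  proof -
    have "f a b c d + f a d b c + f b d c a = (f b c a d + f b a d c + f b d c a)
      + (f a b c d - f b c a d) - (f b a d c - f a d b c)" by simp
    also have "\<dots> \<in> I" by (intro mems cyc rot Y)
    finally show ?thesis .
  qed
  have C: "f a b c d + f b d c a + f a c d b \<in> I"
  proof -
    have "f a b c d + f b d c a + f a c d b = (f c a b d + f c b d a + f c d a b)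
      - (f c a b d - f a b c d) - (f c b d a - f b d c a) - (f c d a b - f d a c b) - (f d a c b - f a c d b)" by simp
    also have "\<dots> \<in> I" by (intro mems cyc rot Y)
    finally show ?thesis .
  qed
  have D: "f b d c a + f a c d b + f a d b c \<in> I"
  proof -
    have "f b d c a + f a c d b + f a d b c = (f d c b a + f d b a c + f d a c b)
      - ((f d c b a - f c b d a) + (f c b d a - f b d c a))
      - ((f d b a c - f b a d c) + (f b a d c - f a d b c)) - (f d a c b - f a c d b)" by simp
    also have "\<dots> \<in> I" by (intro mems cyc rot Y)
    finally show ?thesis .
  qed
  \<comment> \<open>The sum of \<open>A\<close>, \<open>B\<close> and \<open>C\<close> contains \<open>f a b c d\<close> three times and each value in \<open>D\<close> twice.\<close>
  have "f a b c d + f a b c d + f a b c d \<in> I"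
    using diff_mem[OF diff_mem[OF add_mem[OF add_mem[OF A B] C] D] D] by (simp add: algebra_simps)
  then show ?thesis by (rule third_mem)
qed

text \<open>
  The preimage of the second term of the upper central series of the quotient by \<open>I\<close>, regarded as a Lie ring.
\<close>

definition second_centre :: "'a set" where
  "second_centre = {u. \<forall>p q. u \<diamond> p \<diamond> q \<in> I}"

lemma second_centreD: "u \<in> second_centre \<Longrightarrow> u \<diamond> p \<diamond> q \<in> I"
  by (simp add: second_centre_def)

lemma second_centre_commutes:
  assumes "u \<in> second_centre"
  shows "u \<diamond> (p \<diamond> q) \<in> I"
proof -
  have "u \<diamond> (p \<diamond> q) = u \<diamond> p \<diamond> q - u \<diamond> q \<diamond> p" by (simp add: lie_def algebra_simps)
  also have "\<dots> \<in> I" using assms by (intro diff_mem second_centreD)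
  finally show ?thesis .
qed

text \<open>
  Expanding \<open>[u, pq, r]\<close> by the Leibniz rule leaves exactly the two mixed products. Together with the
  antisymmetry of \<open>[q, r]\<close> this makes \<open>[u, p][q, r]\<close> antisymmetric in \<open>p, q, r\<close>.
\<close>

lemma second_centre_exchange:
  assumes "u \<in> second_centre"
  shows "(u \<diamond> p) * (q \<diamond> r) + (u \<diamond> q) * (p \<diamond> r) \<in> I"
proof -
  have "(u \<diamond> p) * (q \<diamond> r) + (u \<diamond> q) * (p \<diamond> r) = u \<diamond> (p * q) \<diamond> r
      - p * (u \<diamond> q \<diamond> r) - (u \<diamond> p \<diamond> r) * q + u \<diamond> q \<diamond> (p \<diamond> r)"
    by (simp add: lie_def algebra_simps)
  also have "\<dots> \<in> I" using assms by (intro mems second_centreD)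
  finally show ?thesis .
qed

text \<open>
  The commutator of the exchange relation with \<open>s\<close> shows that \<open>[u, p][q, r, s]\<close> is antisymmetric in
  \<open>p, q, r\<close>, and \<open>[q, r, s]\<close> satisfies the Jacobi identity.
\<close>

lemma second_centre_kills:
  assumes "u \<in> second_centre"
  shows "(u \<diamond> p) * (q \<diamond> r \<diamond> s) \<in> I"
proof (rule four_letter_identity[where f = "\<lambda>p q r s. (u \<diamond> p) * (q \<diamond> r \<diamond> s)" and Y = UNIV])
  fix p q r s
  have "(u \<diamond> p) * (q \<diamond> r \<diamond> s) + (u \<diamond> q) * (p \<diamond> r \<diamond> s) =
    ((u \<diamond> p) * (q \<diamond> r) + (u \<diamond> q) * (p \<diamond> r)) \<diamond> s
    - (u \<diamond> p \<diamond> s) * (q \<diamond> r) - (u \<diamond> q \<diamond> s) * (p \<diamond> r)"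
    by (simp add: lie_def algebra_simps)
  also have "\<dots> \<in> I"
    using assms by (intro mems second_centreD second_centre_exchange)
  finally show "(u \<diamond> p) * (q \<diamond> r \<diamond> s) + (u \<diamond> q) * (p \<diamond> r \<diamond> s) \<in> I" .
qed (simp_all add: lie_def algebra_simps zero_mem)

text \<open>
  In this context \<open>[w, \<cdot>]\<close> maps monomials of degree one and two into the second centre. The aim is that \<open>[w, x]\<close>
  annihilates the short triple commutators \<open>[b, c, d]\<close> and \<open>[b, yz, d]\<close>.
\<close>

context
  fixes X w
  assumes gen: "ring_generating X"
    and D1: "\<And>x. x \<in> X \<Longrightarrow> w \<diamond> x \<in> second_centre"
    and D2: "\<And>x y. x \<in> X \<Longrightarrow> y \<in> X \<Longrightarrow> w \<diamond> (x * y) \<in> second_centre"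
begin

text \<open>
  Expanding \<open>[w, ab, p, q]\<close> gives the two terms of the claim and four products of double
  commutators such as \<open>[w, b, p][a, q]\<close>. These cancel in pairs by \<open>second_centre_exchange\<close>.
\<close>

lemma generator_exchange:
  assumes "a \<in> X" "b \<in> X"
  shows "(w \<diamond> a) * (b \<diamond> p \<diamond> q) + (w \<diamond> b) * (a \<diamond> p \<diamond> q) \<in> I"
proof -
  note S = D1[OF assms(1)] D1[OF assms(2)]
  have "(w \<diamond> a) * (b \<diamond> p \<diamond> q) + (w \<diamond> b) * (a \<diamond> p \<diamond> q) =
    w \<diamond> (a * b) \<diamond> p \<diamond> q - a * (w \<diamond> b \<diamond> p \<diamond> q) - (w \<diamond> a \<diamond> p \<diamond> q) * b
    + w \<diamond> b \<diamond> (a \<diamond> p \<diamond> q) 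
    + w \<diamond> b \<diamond> q \<diamond> (a \<diamond> p) + w \<diamond> b \<diamond> p \<diamond> (a \<diamond> q)
    - ((w \<diamond> b \<diamond> q) * (a \<diamond> p) + (w \<diamond> b \<diamond> a) * (q \<diamond> p))
    - ((w \<diamond> b \<diamond> p) * (a \<diamond> q) + (w \<diamond> b \<diamond> a) * (p \<diamond> q))
    - ((w \<diamond> a \<diamond> q) * (b \<diamond> p) + (w \<diamond> a \<diamond> b) * (q \<diamond> p))
    - ((w \<diamond> a \<diamond> p) * (b \<diamond> q) + (w \<diamond> a \<diamond> b) * (p \<diamond> q))"
    by (simp add: lie_def algebra_simps)
  also have "\<dots> \<in> I"
    using S D2[OF assms]
    by (intro add_mem diff_mem left_mem right_mem second_centre_exchange second_centre_commutes
        second_centreD)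
  finally show ?thesis .
qed

text \<open>
  For \<open>d\<close> a generator this is \<open>four_letter_identity\<close>. The element \<open>d\<close> is then arbitrary because \<open>[b, c, \<cdot>]\<close> is a derivation
  and the error term \<open>[w, a, d][b, c, e]\<close> is covered by \<open>second_centre_kills\<close>.
\<close>

lemma generator_kills_letter_triple:
  assumes "a \<in> X" "b \<in> X" "c \<in> X"
  shows "(w \<diamond> a) * (b \<diamond> c \<diamond> d) \<in> I"
proof (rule ring_generating_induct[OF gen, of "\<lambda>d. (w \<diamond> a) * (b \<diamond> c \<diamond> d) \<in> I"])
  fix d assume "d \<in> X"
  show "(w \<diamond> a) * (b \<diamond> c \<diamond> d) \<in> I"
  proof (rule four_letter_identity[where f = "\<lambda>p q r s. (w \<diamond> p) * (q \<diamond> r \<diamond> s)" and Y = X])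
  qed (use assms \<open>d \<in> X\<close> in \<open>auto intro: generator_exchange\<close>, auto simp: lie_def algebra_simps zero_mem)
next
  fix d e
  assume IH: "(w \<diamond> a) * (b \<diamond> c \<diamond> d) \<in> I" "(w \<diamond> a) * (b \<diamond> c \<diamond> e) \<in> I"
  show "(w \<diamond> a) * (b \<diamond> c \<diamond> (d - e)) \<in> I"
    using diff_mem[OF IH] by (simp add: lie_diff_right right_diff_distrib)
  have "(w \<diamond> a) * (b \<diamond> c \<diamond> (d * e)) = d * ((w \<diamond> a) * (b \<diamond> c \<diamond> e)) +
     (w \<diamond> a \<diamond> d) * (b \<diamond> c \<diamond> e) + (w \<diamond> a) * (b \<diamond> c \<diamond> d) * e"
    by (simp add: lie_def algebra_simps)
  also have "\<dots> \<in> I"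
    by (intro add_mem left_mem[OF IH(2)] right_mem[OF IH(1)] second_centre_kills D1 assms)
  finally show "(w \<diamond> a) * (b \<diamond> c \<diamond> (d * e)) \<in> I" .
qed (simp add: lie_zero_right zero_mem)

lemma generator_kills_letter_triple_multiple:
  assumes "a \<in> X" "b \<in> X" "c \<in> X"
  shows "(w \<diamond> a) * (e * (b \<diamond> c \<diamond> d)) \<in> I"
proof -
  have "(w \<diamond> a) * (e * (b \<diamond> c \<diamond> d)) = (w \<diamond> a) * (b \<diamond> c \<diamond> (e * d)) - (w \<diamond> a) * (b \<diamond> c \<diamond> e) * d"
    by (simp add: lie_def algebra_simps)
  also have "\<dots> \<in> I" by (intro diff_mem right_mem[of "(w \<diamond> a) * (b \<diamond> c \<diamond> e)"] generator_kills_letter_triple assms)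
  finally show ?thesis .
qed

text \<open>
  Let \<open>N(b, y, z, t) = [w, a][b, yz, t]\<close>. It is symmetric in \<open>y, z\<close>, and it is invariant under exchanging
  \<open>(b, t)\<close> with \<open>(y, z)\<close>, because modulo \<open>I\<close> it equals \<open>[w, a]([y, t][b, z] + [b, y][z, t])\<close> where the commutators commute.
  Moving \<open>a\<close> around with \<open>generator_exchange\<close> shows \<open>N(b, y, z, t) = - N(b, t, y, z)\<close>. Since the cyclic
  sum of \<open>N\<close> over \<open>y, z, t\<close> vanishes as well, \<open>N = 0\<close>.
\<close>

lemma generator_kills_product_triple:
  assumes "a \<in> X" "b \<in> X" "y \<in> X" "z \<in> X" "t \<in> X"
  shows "(w \<diamond> a) * (b \<diamond> (y * z) \<diamond> t) \<in> I"
proof -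
  define N where "N a b y z t = (w \<diamond> a) * (b \<diamond> (y * z) \<diamond> t)" for a b y z t
  define Q where "Q a b y z t = (w \<diamond> a) * ((b \<diamond> y) * (z \<diamond> t))" for a b y z t
  have i: "N a b y z t + N b a y z t \<in> I" if "a \<in> X" "b \<in> X" for a b y z t
    unfolding N_def using generator_exchange[OF that] .
  have Q: "Q a b y z t - Q a z t b y \<in> I" if "a \<in> X" "b \<in> X" "y \<in> X" for a b y z t
  proof -
    have "Q a b y z t - Q a z t b y = (w \<diamond> a) * (b \<diamond> y \<diamond> (z \<diamond> t))"
      unfolding Q_def by (simp add: lie_def algebra_simps)
    then show ?thesis using generator_kills_letter_triple[OF that] by simp
  qed
  have NQ: "N a b y z t - (Q a y t b z + Q a b y z t) \<in> I"
    if "a \<in> X" "b \<in> X" "y \<in> X" "z \<in> X" for a b y z t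
  proof -
    have "N a b y z t - (Q a y t b z + Q a b y z t) =
      (w \<diamond> a) * (y * (b \<diamond> z \<diamond> t)) + (w \<diamond> a) * (b \<diamond> y \<diamond> t) * z"
      unfolding N_def Q_def by (simp add: lie_def algebra_simps)
    also have "\<dots> \<in> I"
      by (intro add_mem generator_kills_letter_triple_multiple right_mem[of "(w \<diamond> a) * (b \<diamond> y \<diamond> t)"] generator_kills_letter_triple that)
    finally show ?thesis .
  qed
  have ii: "N a b y z t - N a b z y t \<in> I" if "a \<in> X" "b \<in> X" "y \<in> X" "z \<in> X" for a b y z t
  proof -
    have "N a b y z t - N a b z y t = (w \<diamond> a) * (t * (y \<diamond> z \<diamond> b)) - (w \<diamond> a) * (y \<diamond> z \<diamond> b) * t"
      unfolding N_def by (simp add: lie_def algebra_simps)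
    also have "\<dots> \<in> I"
      by (intro diff_mem generator_kills_letter_triple_multiple right_mem[of "(w \<diamond> a) * (y \<diamond> z \<diamond> b)"] generator_kills_letter_triple that)
    finally show ?thesis .
  qed
  have vi: "N a b y z t - N a y b t z \<in> I"
    if "a \<in> X" "b \<in> X" "y \<in> X" "z \<in> X" "t \<in> X" for a b y z t
  proof -
    have "N a b y z t - N a y b t z =
      (N a b y z t - (Q a y t b z + Q a b y z t)) - (N a y b t z - (Q a b z y t + Q a y b t z))
      + (Q a y t b z - Q a b z y t)"
      unfolding N_def Q_def by (simp add: lie_def algebra_simps)
    also have "\<dots> \<in> I" by (intro add_mem diff_mem NQ Q that)
    finally show ?thesis .
  qed
  have cyc: "N a b y z t + N a b z t y + N a b t y z \<in> I"
    if "a \<in> X" "b \<in> X" "y \<in> X" "z \<in> X" "t \<in> X" for a b y z t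
  proof -
    have "N a b y z t + N a b z t y + N a b t y z =
      (N a b y z t - (Q a y t b z + Q a b y z t)) +
      (N a b z t y - (Q a z y b t + Q a b z t y)) +
      (N a b t y z - (Q a t z b y + Q a b t y z)) +
      (Q a y t b z - Q a b z y t) + (Q a z y b t - Q a b t z y) + (Q a t z b y - Q a b y t z)"
      unfolding N_def Q_def by (simp add: lie_def algebra_simps)
    also have "\<dots> \<in> I" by (intro add_mem diff_mem NQ Q that)
    finally show ?thesis .
  qed
  \<comment> \<open>The transpositions of \<open>a\<close> with \<open>b\<close>, \<open>b\<close> with \<open>y\<close> and \<open>y\<close> with \<open>a\<close>, each reversing the sign, are interleaved
      with the symmetries of \<open>N\<close>; together they exchange \<open>b\<close> and \<open>y\<close> at the cost of one sign, and
      two more symmetries bring the arguments into the claimed order.\<close>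
  have anti: "N a b y z t + N a b t y z \<in> I"
    if "a \<in> X" "b \<in> X" "y \<in> X" "z \<in> X" "t \<in> X" for a b y z t
  proof -
    have "N a b y z t + N a b t y z =
      (N a b y z t + N b a y z t) - (N b a y z t - N b y a t z) - (N b y a t z + N y b a t z)
      + (N y b a t z - N y a b z t) + (N y a b z t + N a y b z t) - (N a y b z t - N a b y t z)
      - (N a b y t z - N a b t y z)" by simp
    also have "\<dots> \<in> I" by (intro add_mem diff_mem i ii vi that)
    finally show ?thesis .
  qed
  have "N a b y z t = (N a b y z t + N a b z t y + N a b t y z)
    + (N a b y z t + N a b t y z) - (N a b t y z + N a b z t y) - (N a b y z t + N a b t y z)"
    by simp
  also have "\<dots> \<in> I" by (intro add_mem diff_mem cyc anti assms)
  finally show ?thesis unfolding N_def .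
qed

end

text \<open>
  Centrality of \<open>[u, bz]\<close> needs \<open>[u, z][b, v] + [u, b][z, v] = 0\<close>. To carry this relation from \<open>b\<close> to \<open>bz\<close>, the factor \<open>z\<close> must be
  moved past \<open>[y, v]\<close> behind \<open>[u, b]\<close>, which is possible since \<open>[u, b]\<close> annihilates \<open>[y, v, z]\<close>. Hence the induction over \<open>b\<close> proves the
  three properties together.
\<close>

lemma commutators_central_if_short_ones_are:
  assumes gen: "ring_generating X"
    and D1: "\<And>x a. x \<in> X \<Longrightarrow> u \<diamond> x \<diamond> a \<in> I"
    and D2: "\<And>x y a. x \<in> X \<Longrightarrow> y \<in> X \<Longrightarrow> u \<diamond> (x * y) \<diamond> a \<in> I"
  shows "u \<diamond> b \<diamond> c \<in> I"
proof -
  have Z: "\<And>x. x \<in> X \<Longrightarrow> u \<diamond> x \<in> second_centre"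
    "\<And>x y. x \<in> X \<Longrightarrow> y \<in> X \<Longrightarrow> u \<diamond> (x * y) \<in> second_centre"
    using D1 D2 lie_mem unfolding second_centre_def by auto
  have ex: "(u \<diamond> y) * (x \<diamond> v) + (u \<diamond> x) * (y \<diamond> v) \<in> I" if "x \<in> X" "y \<in> X" for x y v
  proof -
    have "(u \<diamond> y) * (x \<diamond> v) + (u \<diamond> x) * (y \<diamond> v) =
      u \<diamond> (x * y) \<diamond> v - x * (u \<diamond> y \<diamond> v) - (u \<diamond> x \<diamond> v) * y + u \<diamond> y \<diamond> (x \<diamond> v)"
      by (simp add: lie_def algebra_simps)
    also have "\<dots> \<in> I" by (intro add_mem diff_mem left_mem right_mem D1 D2 that)
    finally show ?thesis .
  qed
  have "(\<forall>c. u \<diamond> b \<diamond> c \<in> I) \<and> (\<forall>y\<in>X. \<forall>v\<in>X. \<forall>c. (u \<diamond> b) * (y \<diamond> v \<diamond> c) \<in> I)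
      \<and> (\<forall>y\<in>X. \<forall>v\<in>X. (u \<diamond> y) * (b \<diamond> v) + (u \<diamond> b) * (y \<diamond> v) \<in> I)" (is "?P b")
  proof (rule ring_generating_induct_right[OF gen, of ?P])
    show "?P 0" by (simp add: lie_zero_left lie_zero_right zero_mem)
  next
    fix x assume "x \<in> X"
    then show "?P x"
      using D1 generator_kills_letter_triple[OF gen Z] ex by blast
  next
    fix a b assume P: "?P a" "?P b"
    show "?P (a - b)"
    proof (intro conjI ballI allI)
      fix c show "u \<diamond> (a - b) \<diamond> c \<in> I"
        using P by (auto simp: lie_diff_right lie_diff_left intro: diff_mem)
    next
      fix y v c assume "y \<in> X" "v \<in> X"
      then show "(u \<diamond> (a - b)) * (y \<diamond> v \<diamond> c) \<in> I"
        using P by (auto simp: lie_diff_right left_diff_distrib intro: diff_mem)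
    next
      fix y v assume yv: "y \<in> X" "v \<in> X"
      have "(u \<diamond> y) * ((a - b) \<diamond> v) + (u \<diamond> (a - b)) * (y \<diamond> v) =
        ((u \<diamond> y) * (a \<diamond> v) + (u \<diamond> a) * (y \<diamond> v)) - ((u \<diamond> y) * (b \<diamond> v) + (u \<diamond> b) * (y \<diamond> v))"
        by (simp add: lie_diff_right lie_diff_left algebra_simps)
      also have "\<dots> \<in> I" using P yv by (auto intro: diff_mem)
      finally show "(u \<diamond> y) * ((a - b) \<diamond> v) + (u \<diamond> (a - b)) * (y \<diamond> v) \<in> I" .
    qed
  next
    fix b z assume P: "?P b" and z: "z \<in> X"
    show "?P (b * z)"
    proof (intro conjI ballI allI)
      fix c
      have "u \<diamond> (b * z) \<diamond> v \<in> I" if "v \<in> X" for v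
      proof -
        have "u \<diamond> (b * z) \<diamond> v = b * (u \<diamond> z \<diamond> v) + (u \<diamond> b \<diamond> v) * z
          + ((u \<diamond> z) * (b \<diamond> v) + (u \<diamond> b) * (z \<diamond> v)) - u \<diamond> z \<diamond> (b \<diamond> v)"
          by (simp add: lie_def algebra_simps)
        also have "\<dots> \<in> I"
        proof (rule diff_mem[OF add_mem[OF add_mem]])
          show "b * (u \<diamond> z \<diamond> v) \<in> I" "u \<diamond> z \<diamond> (b \<diamond> v) \<in> I"
            using D1[OF z] by (auto intro: left_mem)
          show "(u \<diamond> b \<diamond> v) * z \<in> I" "(u \<diamond> z) * (b \<diamond> v) + (u \<diamond> b) * (z \<diamond> v) \<in> I"
            using P z that by (auto intro: right_mem)
        qed
        finally show ?thesis .
      qed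
      then show "u \<diamond> (b * z) \<diamond> c \<in> I"
        by (rule central_mod_if_commutes_with_generators[OF gen])
    next
      fix y v c assume yv: "y \<in> X" "v \<in> X"
      have "(u \<diamond> (b * z)) * (y \<diamond> v \<diamond> c) = b * ((u \<diamond> z) * (y \<diamond> v \<diamond> c))
        + z * ((u \<diamond> b) * (y \<diamond> v \<diamond> c)) + (u \<diamond> b \<diamond> z) * (y \<diamond> v \<diamond> c)"
        by (simp add: lie_def algebra_simps)
      also have "\<dots> \<in> I"
      proof (rule add_mem[OF add_mem])
        show "b * ((u \<diamond> z) * (y \<diamond> v \<diamond> c)) \<in> I"
          by (rule left_mem) (rule generator_kills_letter_triple[OF gen Z z yv])
        show "z * ((u \<diamond> b) * (y \<diamond> v \<diamond> c)) \<in> I" "(u \<diamond> b \<diamond> z) * (y \<diamond> v \<diamond> c) \<in> I"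
          using P yv by (auto intro: left_mem right_mem)
      qed
      finally show "(u \<diamond> (b * z)) * (y \<diamond> v \<diamond> c) \<in> I" .
    next
      fix y v assume yv: "y \<in> X" "v \<in> X"
      have "(u \<diamond> y) * ((b * z) \<diamond> v) + (u \<diamond> (b * z)) * (y \<diamond> v) =
         b * ((u \<diamond> y) * (z \<diamond> v) + (u \<diamond> z) * (y \<diamond> v)) + (u \<diamond> y \<diamond> b) * (z \<diamond> v)
        + ((u \<diamond> y) * (b \<diamond> v) + (u \<diamond> b) * (y \<diamond> v)) * z - (u \<diamond> b) * (y \<diamond> v \<diamond> z)"
        by (simp add: lie_def algebra_simps)
      also have "\<dots> \<in> I"
      proof (rule diff_mem[OF add_mem[OF add_mem]])
        show "b * ((u \<diamond> y) * (z \<diamond> v) + (u \<diamond> z) * (y \<diamond> v)) \<in> I"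
          by (rule left_mem) (rule ex[OF z yv(1)])
        show "(u \<diamond> y \<diamond> b) * (z \<diamond> v) \<in> I"
          by (rule right_mem) (rule D1[OF yv(1)])
        show "((u \<diamond> y) * (b \<diamond> v) + (u \<diamond> b) * (y \<diamond> v)) * z \<in> I"
          "(u \<diamond> b) * (y \<diamond> v \<diamond> z) \<in> I"
          using P yv by (auto intro: right_mem)
      qed
      finally show "(u \<diamond> y) * ((b * z) \<diamond> v) + (u \<diamond> (b * z)) * (y \<diamond> v) \<in> I" .
    qed
  qed
  then show ?thesis by blast
qed

text \<open>
  The condition on \<open>[u, p]\<close> makes this one-sided annihilator a two-sided ideal when \<open>u\<close> lies in the second centre.
\<close>

definition annihilator :: "'a \<Rightarrow> 'a set" where
  "annihilator u = {t. u * t \<in> I \<and> (\<forall>p. (u \<diamond> p) * t \<in> I)}"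

lemma annihilator_ideal:
  assumes u: "u \<in> second_centre"
  shows "three_saturated_ideal (annihilator u)"
proof
  fix t s r assume t: "t \<in> annihilator u"
  show "t * r \<in> annihilator u"
    using t by (auto simp: annihilator_def right_mem simp flip: mult.assoc)
  have "u * (r * t) = r * (u * t) + (u \<diamond> r) * t" by (simp add: lie_def algebra_simps)
  also have "\<dots> \<in> I" using t by (auto simp: annihilator_def intro: mems)
  finally have "u * (r * t) \<in> I" .
  moreover have "(u \<diamond> p) * (r * t) \<in> I" for p
  proof -
    have "(u \<diamond> p) * (r * t) = r * ((u \<diamond> p) * t) + (u \<diamond> p \<diamond> r) * t"
      by (simp add: lie_def algebra_simps)
    also have "\<dots> \<in> I" using t u by (auto simp: annihilator_def intro: mems second_centreD)
    finally show ?thesis .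
  qed
  ultimately show "r * t \<in> annihilator u" by (simp add: annihilator_def)
qed (auto simp: annihilator_def zero_mem right_diff_distrib distrib_left intro: diff_mem third_mem)

text \<open>
  The elements of the second centre that annihilate all triple commutators. These are the elements
  to which the induction hypothesis for commutators of length \<open>n - 2\<close> will be applied.
\<close>

definition annihilating_centre :: "'a set" where
  "annihilating_centre = {t \<in> second_centre. \<forall>p q r. t * (p \<diamond> q \<diamond> r) \<in> I}"

text \<open>
  In \<open>[tr, c, d]\<close> and \<open>[rt, c, d]\<close> the term with \<open>[r, c, d]\<close> vanishes by the annihilation property, and the two mixed terms
  cancel by \<open>second_centre_exchange\<close>.
\<close>

lemma annihilating_centre_ideal: "three_saturated_ideal annihilating_centre"
proof
  fix t r assume "t \<in> annihilating_centre"
  then have t: "t \<in> second_centre" and ann: "\<And>p q r. t * (p \<diamond> q \<diamond> r) \<in> I"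
    by (auto simp: annihilating_centre_def)
  have ex: "(t \<diamond> c) * (r \<diamond> d) + (t \<diamond> d) * (r \<diamond> c) \<in> I" for c d
  proof -
    have "(t \<diamond> c) * (r \<diamond> d) + (t \<diamond> d) * (r \<diamond> c) =
       ((t \<diamond> c) * (r \<diamond> d) + (t \<diamond> r) * (c \<diamond> d)) + ((t \<diamond> d) * (r \<diamond> c) + (t \<diamond> r) * (d \<diamond> c))"
      by (simp add: lie_def algebra_simps)
    also have "\<dots> \<in> I" by (intro add_mem second_centre_exchange t)
    finally show ?thesis .
  qed
  show "t * r \<in> annihilating_centre"
  proof -
    have "(t * r) \<diamond> c \<diamond> d \<in> I" for c d
    proof -
      have "(t * r) \<diamond> c \<diamond> d =
          t * (r \<diamond> c \<diamond> d) + ((t \<diamond> c) * (r \<diamond> d) + (t \<diamond> d) * (r \<diamond> c)) + (t \<diamond> c \<diamond> d) * r"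
        by (simp add: lie_def algebra_simps)
      also have "\<dots> \<in> I" by (intro add_mem ann ex right_mem second_centreD t)
      finally show ?thesis .
    qed
    moreover have "t * r * (p \<diamond> q \<diamond> s) \<in> I" for p q s
    proof -
      have "t * r * (p \<diamond> q \<diamond> s) = t * (p \<diamond> q \<diamond> (r * s)) - t * (p \<diamond> q \<diamond> r) * s"
        by (simp add: lie_def algebra_simps)
      also have "\<dots> \<in> I" by (intro diff_mem ann right_mem[of "t * (p \<diamond> q \<diamond> r)"])
      finally show ?thesis .
    qed
    ultimately show ?thesis by (simp add: annihilating_centre_def second_centre_def)
  qed
  show "r * t \<in> annihilating_centre"
  proof -
    have "(r * t) \<diamond> c \<diamond> d \<in> I" for c d
    proof -
      have "(r * t) \<diamond> c \<diamond> d = r * (t \<diamond> c \<diamond> d) + ((t \<diamond> c) * (r \<diamond> d) + (t \<diamond> d) * (r \<diamond> c))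
          + t * (r \<diamond> c \<diamond> d) - t \<diamond> (r \<diamond> c \<diamond> d) - t \<diamond> c \<diamond> (r \<diamond> d) - t \<diamond> d \<diamond> (r \<diamond> c)"
        by (simp add: lie_def algebra_simps)
      also have "\<dots> \<in> I"
        by (intro add_mem diff_mem ann ex left_mem[of "t \<diamond> c \<diamond> d"] second_centreD second_centre_commutes t)
      finally show ?thesis .
    qed
    then show ?thesis by (auto simp: annihilating_centre_def second_centre_def mult.assoc intro!: left_mem ann)
  qed
next
  fix s t assume "s \<in> annihilating_centre" "t \<in> annihilating_centre"
  then show "s - t \<in> annihilating_centre"
    by (auto simp: annihilating_centre_def second_centre_def lie_diff_left left_diff_distrib intro: diff_mem)
next
  fix t assume t: "t + t + t \<in> annihilating_centre"
  have "t \<diamond> p \<diamond> q + t \<diamond> p \<diamond> q + t \<diamond> p \<diamond> q \<in> I" for p q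
  proof -
    have "t \<diamond> p \<diamond> q + t \<diamond> p \<diamond> q + t \<diamond> p \<diamond> q = (t + t + t) \<diamond> p \<diamond> q"
      by (simp add: lie_def algebra_simps)
    then show ?thesis using t by (simp add: annihilating_centre_def second_centre_def)
  qed
  with t show "t \<in> annihilating_centre"
    by (auto simp: annihilating_centre_def second_centre_def distrib_right intro: third_mem)
qed (auto simp: annihilating_centre_def second_centre_def lie_zero_left zero_mem)

end

section \<open>Commutators of arbitrary length\<close>

text \<open>
  The left-normed commutators \<open>[x, p\<^sub>1, \<dots>, p\<^sub>k]\<close> with \<open>x \<in> X\<close> and \<open>p\<^sub>i \<in> X \<union> X\<^sup>2\<close>, of length \<open>k + 1\<close>. One more
  commutation, with an element of \<open>X\<close>, yields the generators of the theorem.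
\<close>

primrec short_comms :: "'a::ring set \<Rightarrow> nat \<Rightarrow> 'a set" where
  "short_comms X 0 = X"
| "short_comms X (Suc k) = {v \<diamond> p | v p. v \<in> short_comms X k \<and> (p \<in> X \<or> (\<exists>x\<in>X. \<exists>y\<in>X. p = x * y))}"

primrec all_comms :: "nat \<Rightarrow> 'a::ring set" where
  "all_comms 0 = UNIV"
| "all_comms (Suc k) = {l \<diamond> a | l a. l \<in> all_comms k}"

text \<open>
  Generators lie in the second centre by \<open>commutators_central_if_short_ones_are\<close>. The second centre is always
  closed under products, by the identity \<open>[ab, c] = [a, bc] + [b, ca]\<close>.
\<close>

lemma triple_commutator_mem:
  assumes "ring_generating X" and "three_saturated_ideal I"
    and "\<And>v x. v \<in> short_comms X 1 \<Longrightarrow> x \<in> X \<Longrightarrow> v \<diamond> x \<in> I"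
  shows "a \<diamond> b \<diamond> c \<in> I"
proof -
  interpret three_saturated_ideal I by fact
  have central: "v \<diamond> c \<in> I" if "v \<in> short_comms X 1" for v c
    using central_mod_if_commutes_with_generators[OF assms(1)] assms(3) that by blast
  have X: "x \<diamond> b \<diamond> c \<in> I" if x: "x \<in> X" for x b c
    by (rule commutators_central_if_short_ones_are[OF assms(1)]; rule central) (use x in auto)
  have "\<forall>b c. a \<diamond> b \<diamond> c \<in> I"
  proof (rule ring_generating_induct[OF assms(1), of "\<lambda>a. \<forall>b c. a \<diamond> b \<diamond> c \<in> I"])
    fix a a' assume IH: "\<forall>b c. a \<diamond> b \<diamond> c \<in> I" "\<forall>b c. a' \<diamond> b \<diamond> c \<in> I"
    show "\<forall>b c. (a - a') \<diamond> b \<diamond> c \<in> I"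
      using IH by (auto simp: lie_diff_left intro: diff_mem)
    have "(a * a') \<diamond> b \<diamond> c = a \<diamond> (a' * b) \<diamond> c + a' \<diamond> (b * a) \<diamond> c" for b c
      by (simp add: lie_def algebra_simps)
    then show "\<forall>b c. (a * a') \<diamond> b \<diamond> c \<in> I" using IH by (auto intro: add_mem)
  qed (auto simp: lie_zero_left zero_mem X)
  then show ?thesis by blast
qed

text \<open>
  The annihilator of \<open>[w, x]\<close> is an ideal that contains the short triple commutators, and therefore all of
  them by the case of length three.
\<close>

lemma (in three_saturated_ideal) generator_commutator_in_annihilating_centre:
  assumes gen: "ring_generating X"
    and D1: "\<And>x. x \<in> X \<Longrightarrow> w \<diamond> x \<in> second_centre"
    and D2: "\<And>x y. x \<in> X \<Longrightarrow> y \<in> X \<Longrightarrow> w \<diamond> (x * y) \<in> second_centre"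
    and x: "x \<in> X"
  shows "w \<diamond> x \<in> annihilating_centre"
proof -
  note D = gen D1 D2
  have "p \<diamond> q \<diamond> r \<in> annihilator (w \<diamond> x)" for p q r
  proof (rule triple_commutator_mem[OF gen annihilator_ideal[OF D1[OF x]]])
    fix v y assume "v \<in> short_comms X 1" and y: "y \<in> X"
    then obtain b p where b: "b \<in> X" and v: "v = b \<diamond> p" and p: "p \<in> X \<or> (\<exists>s\<in>X. \<exists>t\<in>X. p = s * t)"
      by auto
    show "v \<diamond> y \<in> annihilator (w \<diamond> x)"
      unfolding v annihilator_def
      using p generator_kills_letter_triple[OF D x b] generator_kills_product_triple[OF D x b _ _ y] second_centre_kills[OF D1[OF x]] by auto
  qed
  then show ?thesis using D1[OF x] by (auto simp: annihilating_centre_def annihilator_def)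
qed

text \<open>
  The induction goes from \<open>k\<close> to \<open>k + 2\<close> and varies the ideal: the step for \<open>I\<close> uses the hypothesis for the
  annihilating centre modulo \<open>I\<close>.
\<close>

theorem all_comms_subset_ideal:
  assumes gen: "ring_generating X" and "three_saturated_ideal I"
    and "\<And>v x. v \<in> short_comms X k \<Longrightarrow> x \<in> X \<Longrightarrow> v \<diamond> x \<in> I"
  shows "all_comms (Suc k) \<subseteq> I"
  using assms(2,3)
proof (induction k arbitrary: I rule: induct_nat_012)
  case 0
  interpret three_saturated_ideal I by fact
  have X: "x \<diamond> a \<in> I" if "x \<in> X" for x a
    using central_mod_if_commutes_with_generators[OF gen] 0(2) that by simp
  have "b \<diamond> a \<in> I" for b a
  proof (rule central_mod_if_commutes_with_generators[OF gen])
    fix x assume "x \<in> X"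
    have "b \<diamond> x = - (x \<diamond> b)" by (simp add: lie_def)
    then show "b \<diamond> x \<in> I" using X[OF \<open>x \<in> X\<close>] uminus_mem by simp
  qed
  then show ?case by auto
next
  case 1
  then show ?case using triple_commutator_mem[OF gen 1(1)] by auto
next
  case (ge2 k)
  interpret three_saturated_ideal I by fact
  have central: "v \<diamond> c \<in> I" if "v \<in> short_comms X (Suc (Suc k))" for v c
    using central_mod_if_commutes_with_generators[OF gen] ge2.prems(2) that by blast
  have Z: "u \<in> second_centre" if u: "u \<in> short_comms X (Suc k)" for u
  proof -
    have "u \<diamond> b \<diamond> c \<in> I" for b c
      by (rule commutators_central_if_short_ones_are[OF gen]; rule central; subst short_comms.simps) (use u in blast)+
    then show ?thesis by (simp add: second_centre_def)
  qed
  have "all_comms (Suc k) \<subseteq> annihilating_centre"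
  proof (rule ge2.IH(1)[OF annihilating_centre_ideal])
    fix w x assume w: "w \<in> short_comms X k" and x: "x \<in> X"
    show "w \<diamond> x \<in> annihilating_centre"
      by (rule generator_commutator_in_annihilating_centre[OF gen _ _ x]; rule Z; subst short_comms.simps) (use w in blast)+
  qed
  then show ?case
    by (auto simp: annihilating_centre_def second_centre_def)
qed

section \<open>The free ring and its evaluation\<close>

text \<open>
  The free ring without unit, constructed as the quotient of the ring terms by the congruence that the ring
  axioms generate. The unit of \<open>A\<close> will be the value of one of the letters.
\<close>

datatype 'a ring_term =
  Letter 'a | Zero | Neg "'a ring_term"
  | Plus "'a ring_term" "'a ring_term" | Times "'a ring_term" "'a ring_term"

inductive ring_equiv :: "'a ring_term \<Rightarrow> 'a ring_term \<Rightarrow> bool" (infix "\<approx>\<^sub>r" 50) where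
  refl: "s \<approx>\<^sub>r s"
| sym: "s \<approx>\<^sub>r t \<Longrightarrow> t \<approx>\<^sub>r s"
| trans: "s \<approx>\<^sub>r t \<Longrightarrow> t \<approx>\<^sub>r u \<Longrightarrow> s \<approx>\<^sub>r u"
| Neg: "s \<approx>\<^sub>r t \<Longrightarrow> Neg s \<approx>\<^sub>r Neg t"
| Plus: "s \<approx>\<^sub>r t \<Longrightarrow> s' \<approx>\<^sub>r t' \<Longrightarrow> Plus s s' \<approx>\<^sub>r Plus t t'"
| Times: "s \<approx>\<^sub>r t \<Longrightarrow> s' \<approx>\<^sub>r t' \<Longrightarrow> Times s s' \<approx>\<^sub>r Times t t'"
| plus_assoc: "Plus (Plus s t) u \<approx>\<^sub>r Plus s (Plus t u)"
| plus_comm: "Plus s t \<approx>\<^sub>r Plus t s"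
| plus_zero: "Plus Zero s \<approx>\<^sub>r s"
| plus_neg: "Plus (Neg s) s \<approx>\<^sub>r Zero"
| times_assoc: "Times (Times s t) u \<approx>\<^sub>r Times s (Times t u)"
| distrib_right: "Times (Plus s t) u \<approx>\<^sub>r Plus (Times s u) (Times t u)"
| distrib_left: "Times s (Plus t u) \<approx>\<^sub>r Plus (Times s t) (Times s u)"

quotient_type 'a free_ring = "'a ring_term" / ring_equiv
  by (intro equivpI reflpI sympI transpI) (fact ring_equiv.refl ring_equiv.sym ring_equiv.trans)+

lift_definition letter :: "'a \<Rightarrow> 'a free_ring" is Letter .

instantiation free_ring :: (type) ring
begin

lift_definition zero_free_ring :: "'a free_ring" is Zero .
lift_definition uminus_free_ring :: "'a free_ring \<Rightarrow> 'a free_ring" is Neg by (rule ring_equiv.Neg)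
lift_definition plus_free_ring :: "'a free_ring \<Rightarrow> 'a free_ring \<Rightarrow> 'a free_ring" is Plus
  by (rule ring_equiv.Plus)
lift_definition times_free_ring :: "'a free_ring \<Rightarrow> 'a free_ring \<Rightarrow> 'a free_ring" is Times
  by (rule ring_equiv.Times)
definition minus_free_ring :: "'a free_ring \<Rightarrow> 'a free_ring \<Rightarrow> 'a free_ring" where
  "minus_free_ring f g = f + - g"

instance
proof
  fix f g h :: "'a free_ring"
  show "f + g + h = f + (g + h)" by transfer (rule ring_equiv.plus_assoc)
  show "f + g = g + f" by transfer (rule ring_equiv.plus_comm)
  show "0 + f = f" by transfer (rule ring_equiv.plus_zero)
  show "- f + f = 0" by transfer (rule ring_equiv.plus_neg)
  show "f - g = f + - g" by (rule minus_free_ring_def)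
  show "f * g * h = f * (g * h)" by transfer (rule ring_equiv.times_assoc)
  show "(f + g) * h = f * h + g * h" by transfer (rule ring_equiv.distrib_right)
  show "f * (g + h) = f * g + f * h" by transfer (rule ring_equiv.distrib_left)
qed

end

lemma free_ring_abs_cases: obtains t where "f = abs_free_ring t"
  using Quotient_abs_rep[OF Quotient_free_ring, of f] by metis

lemma letters_generate: "ring_generating (range letter)"
  unfolding ring_generating_def
proof (intro allI impI)
  fix B :: "'a free_ring set"
  assume zero: "0 \<in> B" and letters: "range letter \<subseteq> B"
    and closed: "\<forall>a\<in>B. \<forall>b\<in>B. a - b \<in> B \<and> a * b \<in> B"
  have neg: "- a \<in> B" if "a \<in> B" for a
    using closed[rule_format, OF zero that] by simp
  have plus: "a + b \<in> B" if "a \<in> B" "b \<in> B" for a b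
    using closed[rule_format, OF that(1) neg[OF that(2)]] by simp
  have "abs_free_ring t \<in> B" for t
  proof (induction t)
    case (Letter x)
    then show ?case using letters by (auto simp: letter.abs_eq)
  next
    case Zero
    then show ?case using zero by (simp add: zero_free_ring.abs_eq)
  next
    case (Neg t)
    then show ?case using neg[OF Neg.IH] by (simp add: uminus_free_ring.abs_eq)
  next
    case (Plus s t)
    then show ?case using plus[OF Plus.IH] by (simp add: plus_free_ring.abs_eq)
  next
    case (Times s t)
    then show ?case using closed[rule_format, OF Times.IH] by (simp add: times_free_ring.abs_eq)
  qed
  then have "f \<in> B" for f by (cases f rule: free_ring_abs_cases) simp
  then show "B = UNIV" by blast
qed

context ring
begin

primrec term_eval :: "('x \<Rightarrow> 'a) \<Rightarrow> 'x ring_term \<Rightarrow> 'a" where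
  "term_eval h (Letter x) = h x"
| "term_eval h Zero = \<zero>"
| "term_eval h (Neg s) = \<ominus> term_eval h s"
| "term_eval h (Plus s t) = term_eval h s \<oplus> term_eval h t"
| "term_eval h (Times s t) = term_eval h s \<otimes> term_eval h t"

definition eval :: "('x \<Rightarrow> 'a) \<Rightarrow> 'x free_ring \<Rightarrow> 'a" where
  "eval h f = term_eval h (rep_free_ring f)"

context
  fixes h :: "'x \<Rightarrow> 'a"
  assumes h: "\<And>x. h x \<in> carrier R"
begin

lemma term_eval_closed [simp]: "term_eval h t \<in> carrier R"
  by (induction t) (simp_all add: h)

lemma term_eval_cong: "s \<approx>\<^sub>r t \<Longrightarrow> term_eval h s = term_eval h t"
proof (induction rule: ring_equiv.induct)
  case (plus_assoc s t u)
  show ?case by (simp add: a_assoc)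
next
  case (plus_comm s t)
  show ?case by (simp add: a_comm)
next
  case (times_assoc s t u)
  show ?case by (simp add: m_assoc)
next
  case (distrib_right s t u)
  show ?case by (simp add: l_distr)
next
  case (distrib_left s t u)
  show ?case by (simp add: r_distr)
qed (simp_all add: l_neg)

lemma eval_abs: "eval h (abs_free_ring t) = term_eval h t"
  unfolding eval_def
  by (rule term_eval_cong) (rule Quotient_rep_abs[OF Quotient_free_ring ring_equiv.refl])

lemma eval_closed [simp]: "eval h f \<in> carrier R"
  by (simp add: eval_def)

lemma eval_simps [simp]:
  "eval h (letter x) = h x"
  "eval h 0 = \<zero>"
  "eval h (- f) = \<ominus> eval h f"
  "eval h (f + g) = eval h f \<oplus> eval h g"
  "eval h (f * g) = eval h f \<otimes> eval h g"
proof -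
  obtain s where f: "f = abs_free_ring s" by (rule free_ring_abs_cases)
  obtain t where g: "g = abs_free_ring t" by (rule free_ring_abs_cases)
  show "eval h (letter x) = h x"
    by (simp add: letter.abs_eq eval_abs)
  show "eval h 0 = \<zero>"
    by (simp add: zero_free_ring.abs_eq eval_abs)
  show "eval h (- f) = \<ominus> eval h f"
    by (simp add: f uminus_free_ring.abs_eq eval_abs)
  show "eval h (f + g) = eval h f \<oplus> eval h g"
    by (simp add: f g plus_free_ring.abs_eq eval_abs)
  show "eval h (f * g) = eval h f \<otimes> eval h g"
    by (simp add: f g times_free_ring.abs_eq eval_abs)
qed

lemma eval_minus [simp]: "eval h (f - g) = eval h f \<ominus> eval h g"
  unfolding minus_free_ring_def a_minus_def by (simp only: eval_simps)

lemma eval_lie [simp]: "eval h (f \<diamond> g) = commutator R (eval h f) (eval h g)"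
  by (simp add: lie_def commutator_def)

lemma eval_foldl: "eval h (foldl (\<diamond>) f fs) = foldl (commutator R) (eval h f) (map (eval h) fs)"
  by (induction fs arbitrary: f) simp_all

end

end

lemma foldl_lie_in_all_comms: "foldl (\<diamond>) f fs \<in> all_comms (length fs)"
proof (induction fs rule: rev_induct)
  case (snoc g fs)
  then have "foldl (\<diamond>) f fs \<diamond> g \<in> all_comms (Suc (length fs))"
    unfolding all_comms.simps by blast
  then show ?case by simp
qed simp

section \<open>Transfer to algebras over a commutative ring\<close>

context assoc_algebra
begin

lemma commutator_closed [simp]:
  "a \<in> carrier A \<Longrightarrow> b \<in> carrier A \<Longrightarrow> commutator A a b \<in> carrier A"
  by (simp add: commutator_def)

lemma smult_mult_smult:
  assumes "r \<in> carrier R" "s \<in> carrier R" "a \<in> carrier A" "b \<in> carrier A"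
  shows "(r \<odot>\<^bsub>A\<^esub> a) \<otimes>\<^bsub>A\<^esub> (s \<odot>\<^bsub>A\<^esub> b) = (r \<otimes>\<^bsub>R\<^esub> s) \<odot>\<^bsub>A\<^esub> (a \<otimes>\<^bsub>A\<^esub> b)"
proof -
  have "(r \<odot>\<^bsub>A\<^esub> a) \<otimes>\<^bsub>A\<^esub> (s \<odot>\<^bsub>A\<^esub> b) = r \<odot>\<^bsub>A\<^esub> (a \<otimes>\<^bsub>A\<^esub> (s \<odot>\<^bsub>A\<^esub> b))"
    using assms by (intro smult_mult_left) simp_all
  also have "a \<otimes>\<^bsub>A\<^esub> (s \<odot>\<^bsub>A\<^esub> b) = s \<odot>\<^bsub>A\<^esub> (a \<otimes>\<^bsub>A\<^esub> b)"
    using assms by (intro smult_mult_right)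
  finally show ?thesis
    using assms by (simp add: smult_assoc1)
qed

lemma commutator_smult:
  assumes "r \<in> carrier R" "s \<in> carrier R" "a \<in> carrier A" "b \<in> carrier A"
  shows "commutator A (r \<odot>\<^bsub>A\<^esub> a) (s \<odot>\<^bsub>A\<^esub> b) = (r \<otimes>\<^bsub>R\<^esub> s) \<odot>\<^bsub>A\<^esub> commutator A a b"
  using assms
  by (simp add: commutator_def smult_mult_smult R.m_comm[of s r] a_minus_def smult_r_distr smult_r_minus)

lemma commutator_one_right: "a \<in> carrier A \<Longrightarrow> commutator A a \<one>\<^bsub>A\<^esub> = \<zero>\<^bsub>A\<^esub>"
  and commutator_one_left: "a \<in> carrier A \<Longrightarrow> commutator A \<one>\<^bsub>A\<^esub> a = \<zero>\<^bsub>A\<^esub>"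
  and commutator_zero_left: "a \<in> carrier A \<Longrightarrow> commutator A \<zero>\<^bsub>A\<^esub> a = \<zero>\<^bsub>A\<^esub>"
  by (simp_all add: commutator_def M.r_neg a_minus_def)

lemma smult_eq_mult_one:
  "r \<in> carrier R \<Longrightarrow> a \<in> carrier A \<Longrightarrow> r \<odot>\<^bsub>A\<^esub> a = (r \<odot>\<^bsub>A\<^esub> \<one>\<^bsub>A\<^esub>) \<otimes>\<^bsub>A\<^esub> a"
  by (simp add: smult_mult_left)

lemma smult_in_ideal:
  assumes "ideal J A" "r \<in> carrier R" "a \<in> J"
  shows "r \<odot>\<^bsub>A\<^esub> a \<in> J"
proof -
  interpret J: ideal J A by fact
  have "r \<odot>\<^bsub>A\<^esub> a = (r \<odot>\<^bsub>A\<^esub> \<one>\<^bsub>A\<^esub>) \<otimes>\<^bsub>A\<^esub> a"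
    using assms J.Icarr by (intro smult_eq_mult_one)
  then show ?thesis using J.I_l_closed assms by simp
qed

text \<open>
  The letters are all elements of the type of \<open>A\<close>. Those that are neither generators nor scalars
  are given the value \<open>0\<close>, so that they cannot contribute to any commutator.
\<close>

definition letter_value :: "'a set \<Rightarrow> 'a \<Rightarrow> 'a" where
  "letter_value X a =
    (if a \<in> X \<union> (\<lambda>r. r \<odot>\<^bsub>A\<^esub> \<one>\<^bsub>A\<^esub>) ` carrier R then a else \<zero>\<^bsub>A\<^esub>)"

context
  fixes X
  assumes X: "X \<subseteq> carrier A"
begin

abbreviation ev :: "'a free_ring \<Rightarrow> 'a" where
  "ev \<equiv> A.eval (letter_value X)"

lemma letter_value_closed: "letter_value X a \<in> carrier A"
  using X by (auto simp: letter_value_def)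

lemma letter_value_generator: "x \<in> X \<Longrightarrow> letter_value X x = x"
  and letter_value_scalar:
    "r \<in> carrier R \<Longrightarrow> letter_value X (r \<odot>\<^bsub>A\<^esub> \<one>\<^bsub>A\<^esub>) = r \<odot>\<^bsub>A\<^esub> \<one>\<^bsub>A\<^esub>"
  by (simp_all add: letter_value_def)

lemmas ev_simps [simp] = A.eval_closed[OF letter_value_closed] A.eval_simps[OF letter_value_closed]
  A.eval_minus[OF letter_value_closed] A.eval_lie[OF letter_value_closed]

lemma ev_surj:
  assumes "generated_subalgebra R A X = carrier A"
  shows "range ev = carrier A"
proof
  show "range ev \<subseteq> carrier A" by auto
  have scalar: "r \<odot>\<^bsub>A\<^esub> \<one>\<^bsub>A\<^esub> = ev (letter (r \<odot>\<^bsub>A\<^esub> \<one>\<^bsub>A\<^esub>))" if "r \<in> carrier R" for r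
    using that by (simp add: letter_value_scalar)
  have smult: "r \<odot>\<^bsub>A\<^esub> ev f = ev (letter (r \<odot>\<^bsub>A\<^esub> \<one>\<^bsub>A\<^esub>) * f)" if "r \<in> carrier R" for r f
    using smult_eq_mult_one[OF that, of "ev f"] that by (simp add: letter_value_scalar)
  have "\<one>\<^bsub>A\<^esub> = ev (letter (\<one>\<^bsub>R\<^esub> \<odot>\<^bsub>A\<^esub> \<one>\<^bsub>A\<^esub>))"
    using scalar[of "\<one>\<^bsub>R\<^esub>"] by simp
  then have one: "\<one>\<^bsub>A\<^esub> \<in> range ev" by blast
  have "subring (range ev) A"
  proof (rule A.subringI)
    fix a b assume "a \<in> range ev" "b \<in> range ev"
    then obtain f g where fg: "a = ev f" "b = ev g" by blast
    show "\<ominus>\<^bsub>A\<^esub> a \<in> range ev"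
      by (rule range_eqI[of _ _ "- f"]) (simp add: fg)
    show "a \<otimes>\<^bsub>A\<^esub> b \<in> range ev"
      by (rule range_eqI[of _ _ "f * g"]) (simp add: fg)
    show "a \<oplus>\<^bsub>A\<^esub> b \<in> range ev"
      by (rule range_eqI[of _ _ "f + g"]) (simp add: fg)
  qed (use one in auto)
  moreover have "X \<subseteq> range ev"
  proof
    fix x assume "x \<in> X"
    then have "x = ev (letter x)" by (simp add: letter_value_generator)
    then show "x \<in> range ev" by blast
  qed
  moreover have "\<forall>r\<in>carrier R. \<forall>b\<in>range ev. r \<odot>\<^bsub>A\<^esub> b \<in> range ev"
    using smult by blast
  ultimately have "generated_subalgebra R A X \<subseteq> range ev"
    unfolding generated_subalgebra_def unital_subalgebra_def by blast
  then show "carrier A \<subseteq> range ev" using assms by simp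
qed

lemma ev_letter:
  "\<exists>r\<in>carrier R. \<exists>s\<in>insert \<one>\<^bsub>A\<^esub> X. ev (letter x) = r \<odot>\<^bsub>A\<^esub> s"
proof (cases "x \<in> X")
  case True
  then have "ev (letter x) = \<one>\<^bsub>R\<^esub> \<odot>\<^bsub>A\<^esub> x"
    using X by (auto simp: letter_value_generator)
  with True show ?thesis by blast
next
  case False
  show ?thesis
  proof (cases "x \<in> (\<lambda>r. r \<odot>\<^bsub>A\<^esub> \<one>\<^bsub>A\<^esub>) ` carrier R")
    case True
    then obtain r where "r \<in> carrier R" "x = r \<odot>\<^bsub>A\<^esub> \<one>\<^bsub>A\<^esub>" by blast
    then show ?thesis by (auto simp: letter_value_scalar)
  next
    case False
    with \<open>x \<notin> X\<close> have "ev (letter x) = \<zero>\<^bsub>R\<^esub> \<odot>\<^bsub>A\<^esub> \<one>\<^bsub>A\<^esub>"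
      by (simp add: letter_value_def)
    then show ?thesis by blast
  qed
qed

lemma ev_short_monomial:
  assumes "p \<in> range letter \<or> (\<exists>x\<in>range letter. \<exists>y\<in>range letter. p = x * y)"
  shows "\<exists>r\<in>carrier R. \<exists>s\<in>insert \<one>\<^bsub>A\<^esub> (X \<union> (X <#>\<^bsub>A\<^esub> X)). ev p = r \<odot>\<^bsub>A\<^esub> s"
  using assms
proof
  assume "p \<in> range letter"
  then obtain x where "p = letter x" by blast
  then show ?thesis using ev_letter[of x] by auto
next
  assume "\<exists>x\<in>range letter. \<exists>y\<in>range letter. p = x * y"
  then obtain x y where p: "p = letter x * letter y" by blast
  obtain r s where x: "r \<in> carrier R" "s \<in> insert \<one>\<^bsub>A\<^esub> X" "ev (letter x) = r \<odot>\<^bsub>A\<^esub> s"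
    using ev_letter[of x] by auto
  obtain r' s' where y: "r' \<in> carrier R" "s' \<in> insert \<one>\<^bsub>A\<^esub> X" "ev (letter y) = r' \<odot>\<^bsub>A\<^esub> s'"
    using ev_letter[of y] by auto
  have s: "s \<in> carrier A" "s' \<in> carrier A" using x(2) y(2) X by auto
  have "ev p = (r \<otimes>\<^bsub>R\<^esub> r') \<odot>\<^bsub>A\<^esub> (s \<otimes>\<^bsub>A\<^esub> s')"
    using p x y s by (simp add: smult_mult_smult del: A.eval_simps(1)[OF letter_value_closed])
  moreover have "s \<otimes>\<^bsub>A\<^esub> s' \<in> insert \<one>\<^bsub>A\<^esub> (X \<union> (X <#>\<^bsub>A\<^esub> X))"
    using x(2) y(2) s by (auto simp: set_mult_def)
  moreover have "r \<otimes>\<^bsub>R\<^esub> r' \<in> carrier R" using x y by simp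
  ultimately show ?thesis by blast
qed

definition short_commutators :: "nat \<Rightarrow> 'a set" where
  "short_commutators k = {left_normed_commutator A (y # ys) | y ys.
     y \<in> X \<and> length ys = k \<and> set ys \<subseteq> X \<union> (X <#>\<^bsub>A\<^esub> X)}"

lemma short_monomials_closed: "X \<union> (X <#>\<^bsub>A\<^esub> X) \<subseteq> carrier A"
  using X by (auto simp: set_mult_def)

lemma foldl_commutator_closed:
  "a \<in> carrier A \<Longrightarrow> set bs \<subseteq> carrier A \<Longrightarrow> foldl (commutator A) a bs \<in> carrier A"
  by (induction bs arbitrary: a) auto

text \<open>
  A scalar factor of an entry can be pulled out of the commutator. An entry that is itself a
  scalar makes the commutator zero; in the first position it does so only at the next commutation, which is why
  the alternative allows an element that commutes with everything.
\<close>

lemma ev_short_comms: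
  assumes "v \<in> short_comms (range letter) k"
  shows "\<exists>r\<in>carrier R. \<exists>s\<in>carrier A. ev v = r \<odot>\<^bsub>A\<^esub> s \<and>
    (s \<in> short_commutators k \<or> (\<forall>a\<in>carrier A. commutator A s a = \<zero>\<^bsub>A\<^esub>))"
  using assms
proof (induction k arbitrary: v)
  case 0
  then obtain x where "v = letter x" by auto
  then obtain r s where rs: "r \<in> carrier R" "s \<in> insert \<one>\<^bsub>A\<^esub> X" "ev v = r \<odot>\<^bsub>A\<^esub> s"
    using ev_letter by blast
  have "s \<in> short_commutators 0 \<or> (\<forall>a\<in>carrier A. commutator A s a = \<zero>\<^bsub>A\<^esub>)"
    using rs(2) by (auto simp: short_commutators_def left_normed_commutator_def commutator_one_left)
  with rs X show ?case by blast
next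
  case (Suc k)
  then obtain w p where v: "v = w \<diamond> p" and w: "w \<in> short_comms (range letter) k"
    and p: "p \<in> range letter \<or> (\<exists>x\<in>range letter. \<exists>y\<in>range letter. p = x * y)"
    unfolding short_comms.simps by blast
  obtain r s where rs: "r \<in> carrier R" "s \<in> carrier A" "ev w = r \<odot>\<^bsub>A\<^esub> s"
    and s: "s \<in> short_commutators k \<or> (\<forall>a\<in>carrier A. commutator A s a = \<zero>\<^bsub>A\<^esub>)"
    using Suc.IH[OF w] by blast
  obtain r' y where y: "r' \<in> carrier R" "y \<in> insert \<one>\<^bsub>A\<^esub> (X \<union> (X <#>\<^bsub>A\<^esub> X))" "ev p = r' \<odot>\<^bsub>A\<^esub> y"
    using ev_short_monomial[OF p] by blast
  have yA: "y \<in> carrier A" using y(2) short_monomials_closed by auto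
  have "ev v = (r \<otimes>\<^bsub>R\<^esub> r') \<odot>\<^bsub>A\<^esub> commutator A s y"
    using rs y yA by (simp add: v commutator_smult)
  moreover have "commutator A s y \<in> short_commutators (Suc k) \<or>
    (\<forall>a\<in>carrier A. commutator A (commutator A s y) a = \<zero>\<^bsub>A\<^esub>)"
  proof (cases "s \<in> short_commutators k \<and> y \<in> X \<union> (X <#>\<^bsub>A\<^esub> X)")
    case True
    then obtain z zs where z: "z \<in> X" "length zs = k" "set zs \<subseteq> X \<union> (X <#>\<^bsub>A\<^esub> X)"
      "s = left_normed_commutator A (z # zs)"
      by (auto simp: short_commutators_def)
    have "commutator A s y = left_normed_commutator A (z # zs @ [y])"
      by (simp add: z left_normed_commutator_def)
    moreover have "length (zs @ [y]) = Suc k" "set (zs @ [y]) \<subseteq> X \<union> (X <#>\<^bsub>A\<^esub> X)"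
      using z True by auto
    ultimately show ?thesis using z(1) unfolding short_commutators_def by blast
  next
    case False
    then have "commutator A s y = \<zero>\<^bsub>A\<^esub>"
      using s y(2) yA rs(2) by (auto simp: commutator_one_right)
    then show ?thesis by (simp add: commutator_zero_left)
  qed
  ultimately show ?case using rs y yA by (meson R.m_closed commutator_closed)
qed

text \<open>
  The preimage of \<open>J\<close> under the evaluation of the free ring satisfies the hypotheses of
  \<open>all_comms_subset_ideal\<close>.
\<close>

lemma left_normed_commutator_in_ideal:
  assumes gen: "generated_subalgebra R A X = carrier A"
    and third: "\<one>\<^bsub>R\<^esub> \<oplus>\<^bsub>R\<^esub> \<one>\<^bsub>R\<^esub> \<oplus>\<^bsub>R\<^esub> \<one>\<^bsub>R\<^esub> \<in> Units R"
    and J: "ideal J A"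
    and SJ: "\<And>s x. s \<in> short_commutators k \<Longrightarrow> x \<in> X \<Longrightarrow> commutator A s x \<in> J"
    and as: "length as = Suc (Suc k)" "set as \<subseteq> carrier A"
  shows "left_normed_commutator A as \<in> J"
proof -
  interpret J: ideal J A by fact
  define I where "I = {f. ev f \<in> J}"
  have "three_saturated_ideal I"
  proof
    fix f assume "f + f + f \<in> I"
    then have fff: "ev f \<oplus>\<^bsub>A\<^esub> ev f \<oplus>\<^bsub>A\<^esub> ev f \<in> J" by (simp add: I_def)
    let ?three = "\<one>\<^bsub>R\<^esub> \<oplus>\<^bsub>R\<^esub> \<one>\<^bsub>R\<^esub> \<oplus>\<^bsub>R\<^esub> \<one>\<^bsub>R\<^esub>"
    have "ev f \<oplus>\<^bsub>A\<^esub> ev f \<oplus>\<^bsub>A\<^esub> ev f = ?three \<odot>\<^bsub>A\<^esub> ev f"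
      by (simp add: smult_l_distr)
    then have "inv\<^bsub>R\<^esub> ?three \<odot>\<^bsub>A\<^esub> (?three \<odot>\<^bsub>A\<^esub> ev f) \<in> J"
      using smult_in_ideal[OF J _ fff, of "inv\<^bsub>R\<^esub> ?three"] third by simp
    then have "ev f \<in> J"
      using third by (simp flip: smult_assoc1)
    then show "f \<in> I" by (simp add: I_def)
  qed (auto simp: I_def J.I_l_closed J.I_r_closed J.zero_closed a_minus_def J.a_closed J.a_inv_closed)
  moreover have "v \<diamond> x \<in> I" if v: "v \<in> short_comms (range letter) k" and x: "x \<in> range letter" for v x
  proof -
    obtain r s where rs: "r \<in> carrier R" "s \<in> carrier A" "ev v = r \<odot>\<^bsub>A\<^esub> s"
      and s: "s \<in> short_commutators k \<or> (\<forall>a\<in>carrier A. commutator A s a = \<zero>\<^bsub>A\<^esub>)"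
      using ev_short_comms[OF v] by blast
    obtain r' y where y: "r' \<in> carrier R" "y \<in> insert \<one>\<^bsub>A\<^esub> X" "ev x = r' \<odot>\<^bsub>A\<^esub> y"
      using ev_letter x by blast
    have yA: "y \<in> carrier A" using y(2) X by auto
    have "ev (v \<diamond> x) = (r \<otimes>\<^bsub>R\<^esub> r') \<odot>\<^bsub>A\<^esub> commutator A s y"
      using rs y yA by (simp add: commutator_smult)
    moreover have "commutator A s y \<in> J"
      using s y(2) yA rs(2) SJ by (auto simp: commutator_one_right J.zero_closed)
    ultimately show ?thesis
      using smult_in_ideal[OF J] rs y by (simp add: I_def)
  qed
  ultimately have sub: "all_comms (Suc k) \<subseteq> I"
    by (intro all_comms_subset_ideal[OF letters_generate])
  have "as \<in> lists (range ev)" using as(2) ev_surj[OF gen] by auto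
  then obtain gs where gs: "as = map ev gs" by (auto simp: lists_image[of ev UNIV])
  then obtain f fs where "gs = f # fs" "length fs = Suc k"
    using as(1) by (cases gs) auto
  with gs have "as = map ev (f # fs)" by simp
  then have "left_normed_commutator A as = ev (foldl (\<diamond>) f fs)"
    by (simp add: left_normed_commutator_def A.eval_foldl[OF letter_value_closed])
  moreover have "foldl (\<diamond>) f fs \<in> I"
    using foldl_lie_in_all_comms[of f fs] sub \<open>length fs = Suc k\<close> by auto
  ultimately show ?thesis by (simp add: I_def)
qed

end

end

theorem theorem1p2:
  fixes R :: "('r, 'c) ring_scheme"
    and A :: "('r, 'a, 'd) module_scheme"
    and X :: "'a set"
    and n :: nat
  assumes "assoc_algebra R A"
    and "\<one>\<^bsub>R\<^esub> \<oplus>\<^bsub>R\<^esub> \<one>\<^bsub>R\<^esub> \<oplus>\<^bsub>R\<^esub> \<one>\<^bsub>R\<^esub> \<in> Units R"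
    and "X \<subseteq> carrier A"
    and "generated_subalgebra R A X = carrier A"
    and "n \<ge> 2"
  shows "T_ideal A n =
    Idl\<^bsub>A\<^esub> {left_normed_commutator A (y\<^sub>1 # ys @ [y\<^sub>n]) | y\<^sub>1 ys y\<^sub>n.
            y\<^sub>1 \<in> X \<and> y\<^sub>n \<in> X \<and> length ys = n - 2 \<and>
            set ys \<subseteq> X \<union> (X <#>\<^bsub>A\<^esub> X)}"
    (is "_ = Idl\<^bsub>A\<^esub> ?S")
proof -
  interpret assoc_algebra R A by fact
  obtain k where n: "n = Suc (Suc k)" using \<open>n \<ge> 2\<close> by (metis add_2_eq_Suc le_Suc_ex)
  let ?T = "{left_normed_commutator A as | as. length as = n \<and> set as \<subseteq> carrier A}"
  have T: "?T \<subseteq> carrier A"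
  proof
    fix c assume "c \<in> ?T"
    then obtain as where "c = left_normed_commutator A as" "length as = n" "set as \<subseteq> carrier A"
      by blast
    then show "c \<in> carrier A"
      using n by (cases as)
        (auto simp: left_normed_commutator_def intro!: foldl_commutator_closed)
  qed
  have ST: "?S \<subseteq> ?T"
  proof
    fix c assume "c \<in> ?S"
    then obtain y ys z where y: "y \<in> X" "z \<in> X" "length ys = n - 2"
      "set ys \<subseteq> X \<union> (X <#>\<^bsub>A\<^esub> X)" and c: "c = left_normed_commutator A (y # ys @ [z])"
      by blast
    then have "length (y # ys @ [z]) = n" "set (y # ys @ [z]) \<subseteq> carrier A"
      using n short_monomials_closed[OF assms(3)] assms(3) by auto
    then show "c \<in> ?T" unfolding c by blast
  qed
  have J: "ideal (Idl\<^bsub>A\<^esub> ?S) A"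
    using ST T by (intro A.genideal_ideal) blast
  have "?T \<subseteq> Idl\<^bsub>A\<^esub> ?S"
  proof
    fix c assume "c \<in> ?T"
    then obtain as where as: "length as = n" "set as \<subseteq> carrier A"
      and c: "c = left_normed_commutator A as"
      by blast
    show "c \<in> Idl\<^bsub>A\<^esub> ?S"
      unfolding c
    proof (rule left_normed_commutator_in_ideal[OF assms(3,4,2) J _ _ as(2), of k])
      fix s x assume "s \<in> short_commutators X k" "x \<in> X"
      then obtain y ys where "y \<in> X" "length ys = k" "set ys \<subseteq> X \<union> (X <#>\<^bsub>A\<^esub> X)"
        and s: "s = left_normed_commutator A (y # ys)"
        using assms(3) by (auto simp: short_commutators_def)
      moreover have "commutator A s x = left_normed_commutator A (y # ys @ [x])"
        by (simp add: s left_normed_commutator_def)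
      ultimately have "commutator A s x \<in> ?S" using n \<open>x \<in> X\<close> by auto
      then show "commutator A s x \<in> Idl\<^bsub>A\<^esub> ?S"
        using A.genideal_self ST T by blast
    qed (use as n in simp)
  qed
  then have "Idl\<^bsub>A\<^esub> ?T \<subseteq> Idl\<^bsub>A\<^esub> ?S" by (rule A.genideal_minimal[OF J])
  moreover have "Idl\<^bsub>A\<^esub> ?S \<subseteq> Idl\<^bsub>A\<^esub> ?T"
    using ST T A.genideal_self[OF T] by (intro A.genideal_minimal A.genideal_ideal) auto
  ultimately show ?thesis by (simp add: T_ideal_def)
qed

end
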